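(* Let $\mathcal{Q}_{\mathcal{B}}$ be the free quantaloid on a category $\mathcal{B}$. If $p\colon\mathcal{E}\to\mathcal{B}$ is a faithful functor corresponding to a $\mathcal{Q}_{\mathcal{B}}$-category $\bar{\mathcal{E}}$, then the MacNeille completion of $p$ as a faithful functor corresponds to the MacNeille completion $\mathcal{R}\bar{\mathcal{E}}$ of $\bar{\mathcal{E}}$ as a quantaloid-enriched category; that is, the faithful functor into $\mathcal{B}$ corresponding to the $\mathcal{Q}_{\mathcal{B}}$-category $\mathcal{R}\bar{\mathcal{E}}$ is isomorphic over $\mathcal{B}$ to the MacNeille completion of $p$.
   Context: Size: fix a Grothendieck universe; sets in it are small. All ordinary categories have small hom-sets and a possibly large set of objects. MacNeille completion of a faithful functor (Herrlich). Let $p\colon\mathcal{E}\to\mathcal{B}$ be faithful. A map $k\colon py\to px$ lifts to $y\to x$ if $k=p(f)$ for some $f\colon y\to x$ in $\mathcal{E}$. A $p$-sieve on $z\in\mathcal{B}$ is a subfunctor $\phi\subseteq\mathcal{B}(p-,z)$; a $p$-cosieve on $z$ is a subfunctor $\psi\subseteq\mathcal{B}(z,p-)$. For a sieve $\phi$ on $z$, let ${\uparrow}\phi$ be the cosieve on $z$ of all $g\colon z\to px$ such that $g\circ h\colon py\to px$ lifts to $y\to x$ for all $y$ and all $h\colon py\to z$ in $\phi(y)$; for a cosieve $\psi$ on $z$, let ${\downarrow}\psi$ be the sieve on $z$ of all $h\colon py\to z$ such that $g\circ h\colon py\to px$ lifts to $y\to x$ for all $x$ and all $g\colon z\to px$ in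 $\psi(x)$. The MacNeille completion of $p$ is the following faithful functor into $\mathcal{B}$: objects of its domain are pairs of $z\in\mathcal{B}$ and a $p$-sieve $\phi$ on $z$ with $\phi={\downarrow}{\uparrow}\phi$; morphisms from $\phi$ on $z$ to $\psi$ on $w$ are maps $\theta\colon z\to w$ in $\mathcal{B}$ such that $f\in\phi(x)$ implies $\theta\circ f\in\psi(x)$; the functor to $\mathcal{B}$ sends a sieve on $z$ to $z$ and a morphism to $\theta$. Quantaloids. A quantaloid $\mathcal{Q}$ is a bicategory whose homs $\mathcal{Q}(A,B)$ are complete (small) lattices and whose composition preserves joins in each variable. For $f\colon A\to B$, $[f,-]\colon\mathcal{Q}(A,C)\to\mathcal{Q}(B,C)$ is right adjoint to $(-)\circ f$; for $g\colon B\to C$, $\{g,-\}\colon\mathcal{Q}(A,C)\to\mathcal{Q}(A,B)$ is right adjoint to $g\circ(-)$. A $\mathcal{Q}$-category $\mathcal{C}$ consists of a possibly large set $\mathrm{ob}\,\mathcal{C}$, extents $|x|\in\mathcal{Q}$, and hom-objects $\mathcal{C}(x,y)\in\mathcal{Q}(|x|,|y|)$, with $1_{|x|}\leqslant\mathcal{C}(x,x)$ and $\mathcal{C}(y,z)\circ\mathcal{C}(x,y)\leqslant\mathcal{C}(x,z)$. A presheaf $\phi$ on $\mathcal{C}$ is an object $|\phi|\in\mathcal{Q}$ with arrows $\phi(x)\colon|x|\to|\phi|$ such that $\phi(y)\circ\mathcal{C}(x,y)\leqslant\phi(x)$; these form a $\mathcal{Q}$-category $\mathcal{P}\mathcal{C}$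 with $\mathcal{P}\mathcal{C}(\phi,\psi)=\bigwedge_x[\phi(x),\psi(x)]$, and $Y\colon\mathcal{C}\to\mathcal{P}\mathcal{C}$ sends $x$ to $\mathcal{C}(-,x)$ with extent $|x|$. A copresheaf $\psi$ on $\mathcal{C}$ is an object $|\psi|\in\mathcal{Q}$ with arrows $\psi(x)\colon|\psi|\to|x|$ such that $\mathcal{C}(x,y)\circ\psi(x)\leqslant\psi(y)$; these form a $\mathcal{Q}$-category $\mathcal{P}^\dagger\mathcal{C}$ with $\mathcal{P}^\dagger\mathcal{C}(\phi,\psi)=\bigwedge_x\{\psi(x),\phi(x)\}$, and $Y^\dagger\colon\mathcal{C}\to\mathcal{P}^\dagger\mathcal{C}$ sends $x$ to $\mathcal{C}(x,-)$. The Isbell adjunction ${\uparrow}\dashv{\downarrow}$ between $\mathcal{P}\mathcal{C}$ and $\mathcal{P}^\dagger\mathcal{C}$ is given by $({\uparrow}\phi)(x)=\mathcal{P}\mathcal{C}(\phi,Yx)$ and $({\downarrow}\psi)(x)=\mathcal{P}^\dagger\mathcal{C}(Y^\dagger x,\psi)$, preserving extents. The MacNeille completion $\mathcal{R}\mathcal{C}$ is the full sub-$\mathcal{Q}$-category of $\mathcal{P}\mathcal{C}$ on those $\phi$ with $\phi={\downarrow}{\uparrow}\phi$. Free quantaloid. $\mathcal{Q}_{\mathcal{B}}$ has the objects of $\mathcal{B}$; morphisms from $X$ to $Y$ are subsets $U\subseteq\mathcal{B}(X,Y)$ ordered by inclusion; $V\circ U=\{v\circ u\mid v\in V,u\in U\}$;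 the identity at $X$ is $\{1_X\}$. A faithful functor $p\colon\mathcal{E}\to\mathcal{B}$ corresponds to the $\mathcal{Q}_{\mathcal{B}}$-category $\bar{\mathcal{E}}$ with the objects of $\mathcal{E}$, extents $|x|=px$, and homs $\{p(f)\mid f\in\mathcal{E}(x,y)\}\subseteq\mathcal{B}(px,py)$; conversely a $\mathcal{Q}_{\mathcal{B}}$-category $\mathcal{C}$ corresponds to the faithful functor into $\mathcal{B}$ from the category with object set $\mathrm{ob}\,\mathcal{C}$ and morphisms $x\to y$ the elements of $\mathcal{C}(x,y)\subseteq\mathcal{B}(|x|,|y|)$. *)

theory Defs
  imports "HOL-Algebra.Complete_Lattice" "HOL-Library.FuncSet"
begin

section \<open>Categories and faithful functors\<close>

text \<open>
  Categories are given by a set of objects and a family of hom-sets. Hom-sets of different pairs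
  of objects may overlap, so composition and the action of a functor on maps take the objects as
  arguments: \<open>Comp C x y z g f\<close> is the composite of \<open>f\<close> from \<open>x\<close> to \<open>y\<close> with \<open>g\<close> from \<open>y\<close>
  to \<open>z\<close>. In the same way \<open>QComp Q A B C g f\<close> below is the composite of \<open>f\<close> with \<open>g\<close>.
\<close>

record ('o, 'm) cat =
  Ob :: "'o set"
  Hom :: "'o \<Rightarrow> 'o \<Rightarrow> 'm set"
  Ident :: "'o \<Rightarrow> 'm"
  Comp :: "'o \<Rightarrow> 'o \<Rightarrow> 'o \<Rightarrow> 'm \<Rightarrow> 'm \<Rightarrow> 'm"

locale category =
  fixes C :: "('o, 'm) cat"
  assumes Ident_in: "x \<in> Ob C \<Longrightarrow> Ident C x \<in> Hom C x x"
    and Comp_in: "\<lbrakk>x \<in> Ob C; y \<in> Ob C; z \<in> Ob C; f \<in> Hom C x y; g \<in> Hom C y z\<rbrakk>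
      \<Longrightarrow> Comp C x y z g f \<in> Hom C x z"
    and Comp_Ident_right: "\<lbrakk>x \<in> Ob C; y \<in> Ob C; f \<in> Hom C x y\<rbrakk>
      \<Longrightarrow> Comp C x x y f (Ident C x) = f"
    and Comp_Ident_left: "\<lbrakk>x \<in> Ob C; y \<in> Ob C; f \<in> Hom C x y\<rbrakk>
      \<Longrightarrow> Comp C x y y (Ident C y) f = f"
    and Comp_assoc: "\<lbrakk>w \<in> Ob C; x \<in> Ob C; y \<in> Ob C; z \<in> Ob C;
        f \<in> Hom C w x; g \<in> Hom C x y; h \<in> Hom C y z\<rbrakk>
      \<Longrightarrow> Comp C w x z (Comp C x y z h g) f = Comp C w y z h (Comp C w x y g f)"

record ('o, 'm, 'o2, 'm2) ftor =
  fob :: "'o \<Rightarrow> 'o2"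
  fmap :: "'o \<Rightarrow> 'o \<Rightarrow> 'm \<Rightarrow> 'm2"

locale cat_functor = dom: category C + cod: category D
  for C :: "('o, 'm) cat" and D :: "('o2, 'm2) cat" and F :: "('o, 'm, 'o2, 'm2) ftor" +
  assumes fob_in: "x \<in> Ob C \<Longrightarrow> fob F x \<in> Ob D"
    and fmap_in: "\<lbrakk>x \<in> Ob C; y \<in> Ob C; f \<in> Hom C x y\<rbrakk>
      \<Longrightarrow> fmap F x y f \<in> Hom D (fob F x) (fob F y)"
    and fmap_Ident: "x \<in> Ob C \<Longrightarrow> fmap F x x (Ident C x) = Ident D (fob F x)"
    and fmap_Comp: "\<lbrakk>x \<in> Ob C; y \<in> Ob C; z \<in> Ob C; f \<in> Hom C x y; g \<in> Hom C y z\<rbrakk>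
      \<Longrightarrow> fmap F x z (Comp C x y z g f)
        = Comp D (fob F x) (fob F y) (fob F z) (fmap F y z g) (fmap F x y f)"

locale faithful_functor = cat_functor +
  assumes fmap_inj: "\<lbrakk>x \<in> Ob C; y \<in> Ob C\<rbrakk> \<Longrightarrow> inj_on (fmap F x y) (Hom C x y)"

definition functor_comp ::
  "('o2, 'm2, 'o3, 'm3) ftor \<Rightarrow> ('o, 'm, 'o2, 'm2) ftor \<Rightarrow> ('o, 'm, 'o3, 'm3) ftor" where
  "functor_comp G F = \<lparr>fob = \<lambda>x. fob G (fob F x),
     fmap = \<lambda>x y f. fmap G (fob F x) (fob F y) (fmap F x y f)\<rparr>"

definition id_functor :: "('o, 'm, 'o, 'm) ftor" where
  "id_functor = \<lparr>fob = \<lambda>x. x, fmap = \<lambda>x y f. f\<rparr>"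

text \<open>Equality of functors with domain \<open>C\<close>; values outside \<open>C\<close> are irrelevant.\<close>

definition functor_eq ::
  "('o, 'm) cat \<Rightarrow> ('o, 'm, 'o2, 'm2) ftor \<Rightarrow> ('o, 'm, 'o2, 'm2) ftor \<Rightarrow> bool" where
  "functor_eq C F G \<longleftrightarrow> (\<forall>x\<in>Ob C. fob F x = fob G x) \<and>
     (\<forall>x\<in>Ob C. \<forall>y\<in>Ob C. \<forall>f\<in>Hom C x y. fmap F x y f = fmap G x y f)"

definition iso_over ::
  "('o, 'b) cat \<Rightarrow> ('x, 'f) cat \<Rightarrow> ('x, 'f, 'o, 'b) ftor \<Rightarrow>
   ('y, 'g) cat \<Rightarrow> ('y, 'g, 'o, 'b) ftor \<Rightarrow> bool" where
  "iso_over B D p D' p' \<longleftrightarrow>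
     cat_functor D B p \<and> cat_functor D' B p' \<and>
     (\<exists>F G. cat_functor D D' F \<and> cat_functor D' D G \<and>
        functor_eq D (functor_comp G F) id_functor \<and>
        functor_eq D' (functor_comp F G) id_functor \<and>
        functor_eq D (functor_comp p' F) p)"


section \<open>The MacNeille completion of a faithful functor\<close>

definition lifts ::
  "('x, 'f) cat \<Rightarrow> ('x, 'f, 'o, 'b) ftor \<Rightarrow> 'x \<Rightarrow> 'x \<Rightarrow> 'b \<Rightarrow> bool" where
  "lifts E p y x k \<longleftrightarrow> (\<exists>f\<in>Hom E y x. k = fmap p y x f)"

text \<open>
  Families indexed by objects are extensional (\<open>undefined\<close> outside the object set), so that
  equality of sieves, cosieves, presheaves and copresheaves is equality of families.
\<close>

definition is_sieve ::
  "('x, 'f) cat \<Rightarrow> ('o, 'b) cat \<Rightarrow> ('x, 'f, 'o, 'b) ftor \<Rightarrow> 'o \<Rightarrow> ('x \<Rightarrow> 'b set) \<Rightarrow> bool" where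
  "is_sieve E B p z \<phi> \<longleftrightarrow> \<phi> \<in> (\<Pi>\<^sub>E x\<in>Ob E. Pow (Hom B (fob p x) z)) \<and>
     (\<forall>x\<in>Ob E. \<forall>y\<in>Ob E. \<forall>f\<in>Hom E x y. \<forall>h\<in>\<phi> y.
        Comp B (fob p x) (fob p y) z h (fmap p x y f) \<in> \<phi> x)"

definition is_cosieve ::
  "('x, 'f) cat \<Rightarrow> ('o, 'b) cat \<Rightarrow> ('x, 'f, 'o, 'b) ftor \<Rightarrow> 'o \<Rightarrow> ('x \<Rightarrow> 'b set) \<Rightarrow> bool" where
  "is_cosieve E B p z \<psi> \<longleftrightarrow> \<psi> \<in> (\<Pi>\<^sub>E x\<in>Ob E. Pow (Hom B z (fob p x))) \<and>
     (\<forall>x\<in>Ob E. \<forall>y\<in>Ob E. \<forall>f\<in>Hom E x y. \<forall>g\<in>\<psi> x.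
        Comp B z (fob p x) (fob p y) (fmap p x y f) g \<in> \<psi> y)"

definition sieve_up ::
  "('x, 'f) cat \<Rightarrow> ('o, 'b) cat \<Rightarrow> ('x, 'f, 'o, 'b) ftor \<Rightarrow> 'o \<Rightarrow> ('x \<Rightarrow> 'b set) \<Rightarrow> ('x \<Rightarrow> 'b set)" where
  "sieve_up E B p z \<phi> = (\<lambda>x\<in>Ob E. {g \<in> Hom B z (fob p x).
     \<forall>y\<in>Ob E. \<forall>h\<in>\<phi> y. lifts E p y x (Comp B (fob p y) z (fob p x) g h)})"

definition cosieve_down ::
  "('x, 'f) cat \<Rightarrow> ('o, 'b) cat \<Rightarrow> ('x, 'f, 'o, 'b) ftor \<Rightarrow> 'o \<Rightarrow> ('x \<Rightarrow> 'b set) \<Rightarrow> ('x \<Rightarrow> 'b set)" where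
  "cosieve_down E B p z \<psi> = (\<lambda>y\<in>Ob E. {h \<in> Hom B (fob p y) z.
     \<forall>x\<in>Ob E. \<forall>g\<in>\<psi> x. lifts E p y x (Comp B (fob p y) z (fob p x) g h)})"

definition macneille_cat ::
  "('x, 'f) cat \<Rightarrow> ('o, 'b) cat \<Rightarrow> ('x, 'f, 'o, 'b) ftor \<Rightarrow> ('o \<times> ('x \<Rightarrow> 'b set), 'b) cat" where
  "macneille_cat E B p =
     \<lparr>Ob = {(z, \<phi>). z \<in> Ob B \<and> is_sieve E B p z \<phi> \<and>
              \<phi> = cosieve_down E B p z (sieve_up E B p z \<phi>)},
      Hom = \<lambda>(z, \<phi>) (w, \<psi>). {\<theta> \<in> Hom B z w.
              \<forall>x\<in>Ob E. \<forall>f\<in>\<phi> x. Comp B (fob p x) z w \<theta> f \<in> \<psi> x},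
      Ident = \<lambda>(z, \<phi>). Ident B z,
      Comp = \<lambda>(z, \<phi>) (w, \<psi>) (v, \<chi>). Comp B z w v\<rparr>"

definition macneille_functor :: "('o \<times> ('x \<Rightarrow> 'b set), 'b, 'o, 'b) ftor" where
  "macneille_functor = \<lparr>fob = fst, fmap = \<lambda>\<phi> \<psi> \<theta>. \<theta>\<rparr>"


section \<open>Quantaloids\<close>

record ('o, 'm) qtd =
  QOb :: "'o set"
  QHom :: "'o \<Rightarrow> 'o \<Rightarrow> 'm gorder"
  QIdent :: "'o \<Rightarrow> 'm"
  QComp :: "'o \<Rightarrow> 'o \<Rightarrow> 'o \<Rightarrow> 'm \<Rightarrow> 'm \<Rightarrow> 'm"

definition underlying_cat :: "('o, 'm) qtd \<Rightarrow> ('o, 'm) cat" where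
  "underlying_cat Q = \<lparr>Ob = QOb Q, Hom = \<lambda>A B. carrier (QHom Q A B),
     Ident = QIdent Q, Comp = QComp Q\<rparr>"

text \<open>
  Homs are partially ordered, so the coherence isomorphisms of the bicategory are identities, and
  a bicategory structure is a category with monotone composition. Monotonicity is a consequence
  of the preservation of joins.
\<close>

locale quantaloid =
  fixes Q :: "('o, 'm) qtd"
  assumes underlying_category: "category (underlying_cat Q)"
    and hom_lattice: "\<lbrakk>A \<in> QOb Q; B \<in> QOb Q\<rbrakk> \<Longrightarrow> complete_lattice (QHom Q A B)"
    and comp_Sup_left: "\<lbrakk>A \<in> QOb Q; B \<in> QOb Q; C \<in> QOb Q;
        f \<in> carrier (QHom Q A B); S \<subseteq> carrier (QHom Q B C)\<rbrakk>
      \<Longrightarrow> QComp Q A B C (\<Squnion>\<^bsub>QHom Q B C\<^esub>S) f = \<Squnion>\<^bsub>QHom Q A C\<^esub>((\<lambda>g. QComp Q A B C g f) ` S)"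
    and comp_Sup_right: "\<lbrakk>A \<in> QOb Q; B \<in> QOb Q; C \<in> QOb Q;
        S \<subseteq> carrier (QHom Q A B); g \<in> carrier (QHom Q B C)\<rbrakk>
      \<Longrightarrow> QComp Q A B C g (\<Squnion>\<^bsub>QHom Q A B\<^esub>S) = \<Squnion>\<^bsub>QHom Q A C\<^esub>((\<lambda>f. QComp Q A B C g f) ` S)"

text \<open>
  The values at \<open>h\<close> of the right adjoints \<open>[f,-]\<close> of precomposition with \<open>f\<close> from \<open>A\<close> to \<open>B\<close>, and
  \<open>{g,-}\<close> of postcomposition with \<open>g\<close> from \<open>B\<close> to \<open>C\<close>, where \<open>h\<close> is from \<open>A\<close> to \<open>C\<close>.
\<close>

definition res_pre ::
  "('o, 'm) qtd \<Rightarrow> 'o \<Rightarrow> 'o \<Rightarrow> 'o \<Rightarrow> 'm \<Rightarrow> 'm \<Rightarrow> 'm" where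
  "res_pre Q A B C f h = (THE r. r \<in> carrier (QHom Q B C) \<and>
     (\<forall>g\<in>carrier (QHom Q B C). QComp Q A B C g f \<sqsubseteq>\<^bsub>QHom Q A C\<^esub> h \<longleftrightarrow> g \<sqsubseteq>\<^bsub>QHom Q B C\<^esub> r))"

definition res_post ::
  "('o, 'm) qtd \<Rightarrow> 'o \<Rightarrow> 'o \<Rightarrow> 'o \<Rightarrow> 'm \<Rightarrow> 'm \<Rightarrow> 'm" where
  "res_post Q A B C g h = (THE r. r \<in> carrier (QHom Q A B) \<and>
     (\<forall>f\<in>carrier (QHom Q A B). QComp Q A B C g f \<sqsubseteq>\<^bsub>QHom Q A C\<^esub> h \<longleftrightarrow> f \<sqsubseteq>\<^bsub>QHom Q A B\<^esub> r))"


section \<open>Categories enriched in a quantaloid, and their MacNeille completion\<close>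

record ('x, 'o, 'm) qcat =
  qob :: "'x set"
  ext :: "'x \<Rightarrow> 'o"
  qhom :: "'x \<Rightarrow> 'x \<Rightarrow> 'm"

locale qcategory = quantaloid Q
  for Q :: "('o, 'm) qtd" and C :: "('x, 'o, 'm) qcat" +
  assumes ext_in: "x \<in> qob C \<Longrightarrow> ext C x \<in> QOb Q"
    and qhom_in: "\<lbrakk>x \<in> qob C; y \<in> qob C\<rbrakk> \<Longrightarrow> qhom C x y \<in> carrier (QHom Q (ext C x) (ext C y))"
    and qhom_ident: "x \<in> qob C \<Longrightarrow> QIdent Q (ext C x) \<sqsubseteq>\<^bsub>QHom Q (ext C x) (ext C x)\<^esub> qhom C x x"
    and qhom_comp: "\<lbrakk>x \<in> qob C; y \<in> qob C; z \<in> qob C\<rbrakk>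
      \<Longrightarrow> QComp Q (ext C x) (ext C y) (ext C z) (qhom C y z) (qhom C x y)
        \<sqsubseteq>\<^bsub>QHom Q (ext C x) (ext C z)\<^esub> qhom C x z"

text \<open>Presheaves and copresheaves are pairs of an extent and an extensional family of arrows.\<close>

definition is_presheaf ::
  "('o, 'm) qtd \<Rightarrow> ('x, 'o, 'm) qcat \<Rightarrow> 'o \<times> ('x \<Rightarrow> 'm) \<Rightarrow> bool" where
  "is_presheaf Q C \<phi> \<longleftrightarrow> fst \<phi> \<in> QOb Q \<and>
     snd \<phi> \<in> (\<Pi>\<^sub>E x\<in>qob C. carrier (QHom Q (ext C x) (fst \<phi>))) \<and>
     (\<forall>x\<in>qob C. \<forall>y\<in>qob C.
        QComp Q (ext C x) (ext C y) (fst \<phi>) (snd \<phi> y) (qhom C x y)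
          \<sqsubseteq>\<^bsub>QHom Q (ext C x) (fst \<phi>)\<^esub> snd \<phi> x)"

definition is_copresheaf ::
  "('o, 'm) qtd \<Rightarrow> ('x, 'o, 'm) qcat \<Rightarrow> 'o \<times> ('x \<Rightarrow> 'm) \<Rightarrow> bool" where
  "is_copresheaf Q C \<psi> \<longleftrightarrow> fst \<psi> \<in> QOb Q \<and>
     snd \<psi> \<in> (\<Pi>\<^sub>E x\<in>qob C. carrier (QHom Q (fst \<psi>) (ext C x))) \<and>
     (\<forall>x\<in>qob C. \<forall>y\<in>qob C.
        QComp Q (fst \<psi>) (ext C x) (ext C y) (qhom C x y) (snd \<psi> x)
          \<sqsubseteq>\<^bsub>QHom Q (fst \<psi>) (ext C y)\<^esub> snd \<psi> y)"

definition presheaf_qcat ::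
  "('o, 'm) qtd \<Rightarrow> ('x, 'o, 'm) qcat \<Rightarrow> ('o \<times> ('x \<Rightarrow> 'm), 'o, 'm) qcat" where
  "presheaf_qcat Q C = \<lparr>qob = {\<phi>. is_presheaf Q C \<phi>}, ext = fst,
     qhom = \<lambda>\<phi> \<psi>. \<Sqinter>\<^bsub>QHom Q (fst \<phi>) (fst \<psi>)\<^esub>
       ((\<lambda>x. res_pre Q (ext C x) (fst \<phi>) (fst \<psi>) (snd \<phi> x) (snd \<psi> x)) ` qob C)\<rparr>"

definition copresheaf_qcat ::
  "('o, 'm) qtd \<Rightarrow> ('x, 'o, 'm) qcat \<Rightarrow> ('o \<times> ('x \<Rightarrow> 'm), 'o, 'm) qcat" where
  "copresheaf_qcat Q C = \<lparr>qob = {\<psi>. is_copresheaf Q C \<psi>}, ext = fst,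
     qhom = \<lambda>\<phi> \<psi>. \<Sqinter>\<^bsub>QHom Q (fst \<phi>) (fst \<psi>)\<^esub>
       ((\<lambda>x. res_post Q (fst \<phi>) (fst \<psi>) (ext C x) (snd \<psi> x) (snd \<phi> x)) ` qob C)\<rparr>"

definition yoneda :: "('x, 'o, 'm) qcat \<Rightarrow> 'x \<Rightarrow> 'o \<times> ('x \<Rightarrow> 'm)" where
  "yoneda C x = (ext C x, \<lambda>y\<in>qob C. qhom C y x)"

definition coyoneda :: "('x, 'o, 'm) qcat \<Rightarrow> 'x \<Rightarrow> 'o \<times> ('x \<Rightarrow> 'm)" where
  "coyoneda C x = (ext C x, \<lambda>y\<in>qob C. qhom C x y)"

definition isbell_up ::
  "('o, 'm) qtd \<Rightarrow> ('x, 'o, 'm) qcat \<Rightarrow> 'o \<times> ('x \<Rightarrow> 'm) \<Rightarrow> 'o \<times> ('x \<Rightarrow> 'm)" where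
  "isbell_up Q C \<phi> = (fst \<phi>, \<lambda>x\<in>qob C. qhom (presheaf_qcat Q C) \<phi> (yoneda C x))"

definition isbell_down ::
  "('o, 'm) qtd \<Rightarrow> ('x, 'o, 'm) qcat \<Rightarrow> 'o \<times> ('x \<Rightarrow> 'm) \<Rightarrow> 'o \<times> ('x \<Rightarrow> 'm)" where
  "isbell_down Q C \<psi> = (fst \<psi>, \<lambda>x\<in>qob C. qhom (copresheaf_qcat Q C) (coyoneda C x) \<psi>)"

definition full_sub :: "('x, 'o, 'm) qcat \<Rightarrow> ('x \<Rightarrow> bool) \<Rightarrow> ('x, 'o, 'm) qcat" where
  "full_sub C P = \<lparr>qob = {x \<in> qob C. P x}, ext = ext C, qhom = qhom C\<rparr>"

definition macneille_qcat ::
  "('o, 'm) qtd \<Rightarrow> ('x, 'o, 'm) qcat \<Rightarrow> ('o \<times> ('x \<Rightarrow> 'm), 'o, 'm) qcat" where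
  "macneille_qcat Q C = full_sub (presheaf_qcat Q C) (\<lambda>\<phi>. \<phi> = isbell_down Q C (isbell_up Q C \<phi>))"


section \<open>The free quantaloid on a category\<close>

definition free_quantaloid :: "('o, 'b) cat \<Rightarrow> ('o, 'b set) qtd" where
  "free_quantaloid B = \<lparr>QOb = Ob B,
     QHom = \<lambda>X Y. \<lparr>carrier = Pow (Hom B X Y), eq = (=), le = (\<subseteq>)\<rparr>,
     QIdent = \<lambda>X. {Ident B X},
     QComp = \<lambda>X Y Z V U. {Comp B X Y Z v u | v u. v \<in> V \<and> u \<in> U}\<rparr>"

text \<open>The correspondence between faithful functors into \<open>B\<close> and categories enriched in the free
  quantaloid on \<open>B\<close>.\<close>

definition qcat_of_functor ::
  "('x, 'f) cat \<Rightarrow> ('x, 'f, 'o, 'b) ftor \<Rightarrow> ('x, 'o, 'b set) qcat" where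
  "qcat_of_functor E p = \<lparr>qob = Ob E, ext = fob p, qhom = \<lambda>x y. fmap p x y ` Hom E x y\<rparr>"

definition cat_of_qcat :: "('o, 'b) cat \<Rightarrow> ('x, 'o, 'b set) qcat \<Rightarrow> ('x, 'b) cat" where
  "cat_of_qcat B C = \<lparr>Ob = qob C, Hom = qhom C,
     Ident = \<lambda>x. Ident B (ext C x),
     Comp = \<lambda>x y z. Comp B (ext C x) (ext C y) (ext C z)\<rparr>"

definition functor_of_qcat :: "('x, 'o, 'b set) qcat \<Rightarrow> ('x, 'b, 'o, 'b) ftor" where
  "functor_of_qcat C = \<lparr>fob = ext C, fmap = \<lambda>x y f. f\<rparr>"


section \<open>The constructions are well-defined\<close>

lemma THE_right_adjoint:
  fixes L (structure)
  assumes "partial_order L" "r \<in> carrier L" "\<And>g. g \<in> carrier L \<Longrightarrow> P g \<longleftrightarrow> g \<sqsubseteq> r"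
  shows "(THE r. r \<in> carrier L \<and> (\<forall>g\<in>carrier L. P g \<longleftrightarrow> g \<sqsubseteq> r)) = r"
proof -
  interpret partial_order L by fact
  show ?thesis
    by (rule the_equality) (use assms le_antisym le_refl in blast)+
qed

context quantaloid
begin

lemma QComp_in:
  "\<lbrakk>A \<in> QOb Q; B \<in> QOb Q; C \<in> QOb Q; f \<in> carrier (QHom Q A B); g \<in> carrier (QHom Q B C)\<rbrakk>
    \<Longrightarrow> QComp Q A B C g f \<in> carrier (QHom Q A C)"
  using category.Comp_in[OF underlying_category] by (simp add: underlying_cat_def)

lemma QComp_mono_left:
  assumes "A \<in> QOb Q" "B \<in> QOb Q" "C \<in> QOb Q" "f \<in> carrier (QHom Q A B)"
    "g \<in> carrier (QHom Q B C)" "g' \<in> carrier (QHom Q B C)" "g \<sqsubseteq>\<^bsub>QHom Q B C\<^esub> g'"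
  shows "QComp Q A B C g f \<sqsubseteq>\<^bsub>QHom Q A C\<^esub> QComp Q A B C g' f"
proof -
  interpret BC: complete_lattice "QHom Q B C" using assms hom_lattice by blast
  interpret AC: complete_lattice "QHom Q A C" using assms hom_lattice by blast
  have "\<Squnion>\<^bsub>QHom Q B C\<^esub>{g, g'} = g'"
    using assms by (intro BC.le_antisym BC.sup_least BC.sup_upper BC.sup_closed) auto
  then have "QComp Q A B C g' f = \<Squnion>\<^bsub>QHom Q A C\<^esub>((\<lambda>g. QComp Q A B C g f) ` {g, g'})"
    using comp_Sup_left[of A B C f "{g, g'}"] assms by simp
  moreover have "QComp Q A B C g f \<sqsubseteq>\<^bsub>QHom Q A C\<^esub> \<Squnion>\<^bsub>QHom Q A C\<^esub>((\<lambda>g. QComp Q A B C g f) ` {g, g'})"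
    using assms QComp_in by (intro AC.sup_upper) auto
  ultimately show ?thesis by metis
qed

lemma QComp_mono_right:
  assumes "A \<in> QOb Q" "B \<in> QOb Q" "C \<in> QOb Q" "g \<in> carrier (QHom Q B C)"
    "f \<in> carrier (QHom Q A B)" "f' \<in> carrier (QHom Q A B)" "f \<sqsubseteq>\<^bsub>QHom Q A B\<^esub> f'"
  shows "QComp Q A B C g f \<sqsubseteq>\<^bsub>QHom Q A C\<^esub> QComp Q A B C g f'"
proof -
  interpret AB: complete_lattice "QHom Q A B" using assms hom_lattice by blast
  interpret AC: complete_lattice "QHom Q A C" using assms hom_lattice by blast
  have "\<Squnion>\<^bsub>QHom Q A B\<^esub>{f, f'} = f'"
    using assms by (intro AB.le_antisym AB.sup_least AB.sup_upper AB.sup_closed) auto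
  then have "QComp Q A B C g f' = \<Squnion>\<^bsub>QHom Q A C\<^esub>((\<lambda>f. QComp Q A B C g f) ` {f, f'})"
    using comp_Sup_right[of A B C "{f, f'}" g] assms by simp
  moreover have "QComp Q A B C g f \<sqsubseteq>\<^bsub>QHom Q A C\<^esub> \<Squnion>\<^bsub>QHom Q A C\<^esub>((\<lambda>f. QComp Q A B C g f) ` {f, f'})"
    using assms QComp_in by (intro AC.sup_upper) auto
  ultimately show ?thesis by metis
qed

lemma res_pre_adjoint:
  assumes "A \<in> QOb Q" "B \<in> QOb Q" "C \<in> QOb Q"
    "f \<in> carrier (QHom Q A B)" "h \<in> carrier (QHom Q A C)"
  shows res_pre_in: "res_pre Q A B C f h \<in> carrier (QHom Q B C)"
    and res_pre_iff: "g \<in> carrier (QHom Q B C) \<Longrightarrow>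
      QComp Q A B C g f \<sqsubseteq>\<^bsub>QHom Q A C\<^esub> h \<longleftrightarrow> g \<sqsubseteq>\<^bsub>QHom Q B C\<^esub> res_pre Q A B C f h"
proof -
  interpret BC: complete_lattice "QHom Q B C" using assms hom_lattice by blast
  interpret AC: complete_lattice "QHom Q A C" using assms hom_lattice by blast
  define S where "S = {g \<in> carrier (QHom Q B C). QComp Q A B C g f \<sqsubseteq>\<^bsub>QHom Q A C\<^esub> h}"
  define r where "r = \<Squnion>\<^bsub>QHom Q B C\<^esub>S"
  have S: "S \<subseteq> carrier (QHom Q B C)" by (auto simp: S_def)
  have r: "r \<in> carrier (QHom Q B C)" unfolding r_def using S by simp
  have rf: "QComp Q A B C r f \<sqsubseteq>\<^bsub>QHom Q A C\<^esub> h"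
    unfolding r_def comp_Sup_left[OF assms(1-4) S]
    using assms S QComp_in by (intro AC.sup_least) (auto simp: S_def)
  have iff: "QComp Q A B C g f \<sqsubseteq>\<^bsub>QHom Q A C\<^esub> h \<longleftrightarrow> g \<sqsubseteq>\<^bsub>QHom Q B C\<^esub> r"
    if g: "g \<in> carrier (QHom Q B C)" for g
  proof
    assume "QComp Q A B C g f \<sqsubseteq>\<^bsub>QHom Q A C\<^esub> h"
    with g show "g \<sqsubseteq>\<^bsub>QHom Q B C\<^esub> r" unfolding r_def using S by (intro BC.sup_upper) (auto simp: S_def)
  next
    assume "g \<sqsubseteq>\<^bsub>QHom Q B C\<^esub> r"
    from QComp_mono_left[OF assms(1-4) g r this] rf
    show "QComp Q A B C g f \<sqsubseteq>\<^bsub>QHom Q A C\<^esub> h"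
      using AC.le_trans QComp_in assms g r by meson
  qed
  have eq: "res_pre Q A B C f h = r"
    unfolding res_pre_def using BC.partial_order_axioms r iff by (rule THE_right_adjoint)
  show "res_pre Q A B C f h \<in> carrier (QHom Q B C)" using r eq by simp
  show "g \<in> carrier (QHom Q B C) \<Longrightarrow>
      QComp Q A B C g f \<sqsubseteq>\<^bsub>QHom Q A C\<^esub> h \<longleftrightarrow> g \<sqsubseteq>\<^bsub>QHom Q B C\<^esub> res_pre Q A B C f h"
    using iff eq by simp
qed

lemma res_post_adjoint:
  assumes "A \<in> QOb Q" "B \<in> QOb Q" "C \<in> QOb Q"
    "g \<in> carrier (QHom Q B C)" "h \<in> carrier (QHom Q A C)"
  shows res_post_in: "res_post Q A B C g h \<in> carrier (QHom Q A B)"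
    and res_post_iff: "f \<in> carrier (QHom Q A B) \<Longrightarrow>
      QComp Q A B C g f \<sqsubseteq>\<^bsub>QHom Q A C\<^esub> h \<longleftrightarrow> f \<sqsubseteq>\<^bsub>QHom Q A B\<^esub> res_post Q A B C g h"
proof -
  interpret AB: complete_lattice "QHom Q A B" using assms hom_lattice by blast
  interpret AC: complete_lattice "QHom Q A C" using assms hom_lattice by blast
  define S where "S = {f \<in> carrier (QHom Q A B). QComp Q A B C g f \<sqsubseteq>\<^bsub>QHom Q A C\<^esub> h}"
  define r where "r = \<Squnion>\<^bsub>QHom Q A B\<^esub>S"
  have S: "S \<subseteq> carrier (QHom Q A B)" by (auto simp: S_def)
  have r: "r \<in> carrier (QHom Q A B)" unfolding r_def using S by simp
  have gr: "QComp Q A B C g r \<sqsubseteq>\<^bsub>QHom Q A C\<^esub> h"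
    unfolding r_def comp_Sup_right[OF assms(1-3) S assms(4)]
    using assms S QComp_in by (intro AC.sup_least) (auto simp: S_def)
  have iff: "QComp Q A B C g f \<sqsubseteq>\<^bsub>QHom Q A C\<^esub> h \<longleftrightarrow> f \<sqsubseteq>\<^bsub>QHom Q A B\<^esub> r"
    if f: "f \<in> carrier (QHom Q A B)" for f
  proof
    assume "QComp Q A B C g f \<sqsubseteq>\<^bsub>QHom Q A C\<^esub> h"
    with f show "f \<sqsubseteq>\<^bsub>QHom Q A B\<^esub> r" unfolding r_def using S by (intro AB.sup_upper) (auto simp: S_def)
  next
    assume "f \<sqsubseteq>\<^bsub>QHom Q A B\<^esub> r"
    from QComp_mono_right[OF assms(1-4) f r this] gr
    show "QComp Q A B C g f \<sqsubseteq>\<^bsub>QHom Q A C\<^esub> h"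
      using AC.le_trans QComp_in assms f r by meson
  qed
  have eq: "res_post Q A B C g h = r"
    unfolding res_post_def using AB.partial_order_axioms r iff by (rule THE_right_adjoint)
  show "res_post Q A B C g h \<in> carrier (QHom Q A B)" using r eq by simp
  show "f \<in> carrier (QHom Q A B) \<Longrightarrow>
      QComp Q A B C g f \<sqsubseteq>\<^bsub>QHom Q A C\<^esub> h \<longleftrightarrow> f \<sqsubseteq>\<^bsub>QHom Q A B\<^esub> res_post Q A B C g h"
    using iff eq by simp
qed

end

lemma complete_lattice_Pow:
  fixes H :: "'b set"
  defines "L \<equiv> \<lparr>carrier = Pow H, eq = (=), le = (\<subseteq>)\<rparr>"
  shows "complete_lattice L"
    and Sup_Pow: "S \<subseteq> Pow H \<Longrightarrow> \<Squnion>\<^bsub>L\<^esub>S = \<Union>S"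
    and Inf_Pow: "S \<subseteq> Pow H \<Longrightarrow> \<Sqinter>\<^bsub>L\<^esub>S = H \<inter> \<Inter>S"
proof -
  have lub: "least L (\<Union>S) (Upper L S)" if "S \<subseteq> Pow H" for S
    using that unfolding least_def Upper_def L_def by (simp add: Sup_le_iff) blast
  have glb: "greatest L (H \<inter> \<Inter>S) (Lower L S)" if "S \<subseteq> Pow H" for S
    using that unfolding greatest_def Lower_def L_def by (simp add: le_Inf_iff) blast
  interpret partial_order L by standard (auto simp: L_def)
  show cl: "complete_lattice L"
  proof
    fix S assume "S \<subseteq> carrier L"
    then have S: "S \<subseteq> Pow H" by (simp add: L_def)
    show "\<exists>s. least L s (Upper L S)" "\<exists>s. greatest L s (Lower L S)"
      using lub[OF S] glb[OF S] by blast+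
  qed
  interpret complete_lattice L by (rule cl)
  have carr: "carrier L = Pow H" by (simp add: L_def)
  show "\<Squnion>\<^bsub>L\<^esub>S = \<Union>S" if "S \<subseteq> Pow H"
    using least_unique[OF sup_lub lub] that carr by simp
  show "\<Sqinter>\<^bsub>L\<^esub>S = H \<inter> \<Inter>S" if "S \<subseteq> Pow H"
    using greatest_unique[OF inf_glb glb] that carr by simp
qed

lemma quantaloid_free_quantaloid:
  assumes "category B"
  shows "quantaloid (free_quantaloid B)"
proof -
  interpret category B by fact
  show ?thesis
  proof (rule quantaloid.intro)
    show "category (underlying_cat (free_quantaloid B))"
    proof
      fix x assume "x \<in> Ob (underlying_cat (free_quantaloid B))"
      then show "Ident (underlying_cat (free_quantaloid B)) x
          \<in> Hom (underlying_cat (free_quantaloid B)) x x"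
        by (simp add: underlying_cat_def free_quantaloid_def Ident_in)
    next
      fix x y z U V
      assume "x \<in> Ob (underlying_cat (free_quantaloid B))" "y \<in> Ob (underlying_cat (free_quantaloid B))"
        "z \<in> Ob (underlying_cat (free_quantaloid B))"
        "U \<in> Hom (underlying_cat (free_quantaloid B)) x y"
        "V \<in> Hom (underlying_cat (free_quantaloid B)) y z"
      then show "Comp (underlying_cat (free_quantaloid B)) x y z V U
          \<in> Hom (underlying_cat (free_quantaloid B)) x z"
        by (auto simp: underlying_cat_def free_quantaloid_def intro: Comp_in)
    next
      fix x y U
      assume a: "x \<in> Ob (underlying_cat (free_quantaloid B))" "y \<in> Ob (underlying_cat (free_quantaloid B))"
        "U \<in> Hom (underlying_cat (free_quantaloid B)) x y"
      then have "Comp B x x y u (Ident B x) = u" "Comp B x y y (Ident B y) u = u" if "u \<in> U" for u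
        using that Comp_Ident_left Comp_Ident_right
        by (auto simp: underlying_cat_def free_quantaloid_def)
      then show "Comp (underlying_cat (free_quantaloid B)) x x y U
            (Ident (underlying_cat (free_quantaloid B)) x) = U"
          "Comp (underlying_cat (free_quantaloid B)) x y y
            (Ident (underlying_cat (free_quantaloid B)) y) U = U"
        by (auto simp: underlying_cat_def free_quantaloid_def) metis+
    next
      fix w x y z U V W
      assume a: "w \<in> Ob (underlying_cat (free_quantaloid B))" "x \<in> Ob (underlying_cat (free_quantaloid B))"
        "y \<in> Ob (underlying_cat (free_quantaloid B))" "z \<in> Ob (underlying_cat (free_quantaloid B))"
        "U \<in> Hom (underlying_cat (free_quantaloid B)) w x"
        "V \<in> Hom (underlying_cat (free_quantaloid B)) x y"
        "W \<in> Hom (underlying_cat (free_quantaloid B)) y z"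
      have *: "Comp B w x z (Comp B x y z h g) f = Comp B w y z h (Comp B w x y g f)"
        if "f \<in> U" "g \<in> V" "h \<in> W" for f g h
        using a that Comp_assoc by (auto simp: underlying_cat_def free_quantaloid_def subset_iff)
      show "Comp (underlying_cat (free_quantaloid B)) w x z
          (Comp (underlying_cat (free_quantaloid B)) x y z W V) U =
          Comp (underlying_cat (free_quantaloid B)) w y z W
          (Comp (underlying_cat (free_quantaloid B)) w x y V U)"
        unfolding underlying_cat_def free_quantaloid_def by simp (use * in \<open>blast intro: sym\<close>)
    qed
  next
    fix X Y assume "X \<in> QOb (free_quantaloid B)" "Y \<in> QOb (free_quantaloid B)"
    show "complete_lattice (QHom (free_quantaloid B) X Y)"
      by (simp add: free_quantaloid_def complete_lattice_Pow)
  next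
    fix X Y Z f S
    assume a: "X \<in> QOb (free_quantaloid B)" "Y \<in> QOb (free_quantaloid B)"
      "Z \<in> QOb (free_quantaloid B)" "f \<in> carrier (QHom (free_quantaloid B) X Y)"
      "S \<subseteq> carrier (QHom (free_quantaloid B) Y Z)"
    have "(\<lambda>g. {Comp B X Y Z v u |v u. v \<in> g \<and> u \<in> f}) ` S \<subseteq> Pow (Hom B X Z)"
      using a by (auto simp: free_quantaloid_def intro!: Comp_in)
    then show "QComp (free_quantaloid B) X Y Z (\<Squnion>\<^bsub>QHom (free_quantaloid B) Y Z\<^esub>S) f =
        \<Squnion>\<^bsub>QHom (free_quantaloid B) X Z\<^esub>((\<lambda>g. QComp (free_quantaloid B) X Y Z g f) ` S)"
      using a by (simp add: free_quantaloid_def Sup_Pow) blast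
  next
    fix X Y Z S g
    assume a: "X \<in> QOb (free_quantaloid B)" "Y \<in> QOb (free_quantaloid B)"
      "Z \<in> QOb (free_quantaloid B)" "S \<subseteq> carrier (QHom (free_quantaloid B) X Y)"
      "g \<in> carrier (QHom (free_quantaloid B) Y Z)"
    have "(\<lambda>f. {Comp B X Y Z v u |v u. v \<in> g \<and> u \<in> f}) ` S \<subseteq> Pow (Hom B X Z)"
      using a by (auto simp: free_quantaloid_def intro!: Comp_in)
    then show "QComp (free_quantaloid B) X Y Z g (\<Squnion>\<^bsub>QHom (free_quantaloid B) X Y\<^esub>S) =
        \<Squnion>\<^bsub>QHom (free_quantaloid B) X Z\<^esub>((\<lambda>f. QComp (free_quantaloid B) X Y Z g f) ` S)"
      using a by (simp add: free_quantaloid_def Sup_Pow) blast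
  qed
qed

lemma qcategory_qcat_of_functor:
  assumes "faithful_functor E B p"
  shows "qcategory (free_quantaloid B) (qcat_of_functor E p)"
proof -
  interpret faithful_functor E B p by fact
  interpret quantaloid "free_quantaloid B"
    by (rule quantaloid_free_quantaloid[OF cod.category_axioms])
  show ?thesis
  proof
    fix x y z assume "x \<in> qob (qcat_of_functor E p)" "y \<in> qob (qcat_of_functor E p)"
      "z \<in> qob (qcat_of_functor E p)"
    then show "QComp (free_quantaloid B) (ext (qcat_of_functor E p) x) (ext (qcat_of_functor E p) y)
        (ext (qcat_of_functor E p) z) (qhom (qcat_of_functor E p) y z) (qhom (qcat_of_functor E p) x y)
        \<sqsubseteq>\<^bsub>QHom (free_quantaloid B) (ext (qcat_of_functor E p) x) (ext (qcat_of_functor E p) z)\<^esub>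
        qhom (qcat_of_functor E p) x z"
      by (auto simp: qcat_of_functor_def free_quantaloid_def fmap_Comp[symmetric] intro!: imageI dom.Comp_in)
  qed (auto simp: qcat_of_functor_def free_quantaloid_def fob_in fmap_Ident[symmetric] dom.Ident_in
      intro: fmap_in)
qed

lemma faithful_functor_of_qcat:
  assumes "category B" "qcategory (free_quantaloid B) C"
  shows "faithful_functor (cat_of_qcat B C) B (functor_of_qcat C)"
proof -
  interpret category B by fact
  interpret qcategory "free_quantaloid B" C by fact
  have ob: "ext C x \<in> Ob B" if "x \<in> qob C" for x
    using ext_in[OF that] by (simp add: free_quantaloid_def)
  have hom: "f \<in> Hom B (ext C x) (ext C y)" if "x \<in> qob C" "y \<in> qob C" "f \<in> qhom C x y" for x y f
    using qhom_in[OF that(1,2)] that(3) by (auto simp: free_quantaloid_def)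
  have id: "Ident B (ext C x) \<in> qhom C x x" if "x \<in> qob C" for x
    using qhom_ident[OF that] by (simp add: free_quantaloid_def)
  have comp: "Comp B (ext C x) (ext C y) (ext C z) g f \<in> qhom C x z"
    if "x \<in> qob C" "y \<in> qob C" "z \<in> qob C" "f \<in> qhom C x y" "g \<in> qhom C y z" for x y z f g
    using qhom_comp[OF that(1-3)] that(4,5) by (auto simp: free_quantaloid_def)
  interpret D: category "cat_of_qcat B C"
    by standard (simp_all add: cat_of_qcat_def id comp ob hom Comp_Ident_left Comp_Ident_right Comp_assoc)
  show ?thesis
    by standard (auto simp: cat_of_qcat_def functor_of_qcat_def ob hom)
qed

context qcategory
begin

lemma presheaf_hom:
  assumes "is_presheaf Q C \<phi>" "is_presheaf Q C \<psi>"
  shows presheaf_hom_in: "qhom (presheaf_qcat Q C) \<phi> \<psi> \<in> carrier (QHom Q (fst \<phi>) (fst \<psi>))"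
    and presheaf_hom_iff: "g \<in> carrier (QHom Q (fst \<phi>) (fst \<psi>)) \<Longrightarrow>
      g \<sqsubseteq>\<^bsub>QHom Q (fst \<phi>) (fst \<psi>)\<^esub> qhom (presheaf_qcat Q C) \<phi> \<psi> \<longleftrightarrow>
      (\<forall>x\<in>qob C. QComp Q (ext C x) (fst \<phi>) (fst \<psi>) g (snd \<phi> x) \<sqsubseteq>\<^bsub>QHom Q (ext C x) (fst \<psi>)\<^esub> snd \<psi> x)"
proof -
  have ob: "fst \<phi> \<in> QOb Q" "fst \<psi> \<in> QOb Q"
    and arr: "\<And>x. x \<in> qob C \<Longrightarrow> snd \<phi> x \<in> carrier (QHom Q (ext C x) (fst \<phi>))"
      "\<And>x. x \<in> qob C \<Longrightarrow> snd \<psi> x \<in> carrier (QHom Q (ext C x) (fst \<psi>))"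
    using assms by (auto simp: is_presheaf_def)
  interpret L: complete_lattice "QHom Q (fst \<phi>) (fst \<psi>)" using ob hom_lattice by blast
  let ?r = "\<lambda>x. res_pre Q (ext C x) (fst \<phi>) (fst \<psi>) (snd \<phi> x) (snd \<psi> x)"
  have r: "?r x \<in> carrier (QHom Q (fst \<phi>) (fst \<psi>))" if "x \<in> qob C" for x
    using res_pre_in[OF ext_in[OF that] ob arr[OF that]] .
  then have sub: "?r ` qob C \<subseteq> carrier (QHom Q (fst \<phi>) (fst \<psi>))" by blast
  show "qhom (presheaf_qcat Q C) \<phi> \<psi> \<in> carrier (QHom Q (fst \<phi>) (fst \<psi>))"
    using sub by (simp add: presheaf_qcat_def)
  assume g: "g \<in> carrier (QHom Q (fst \<phi>) (fst \<psi>))"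
  have "g \<sqsubseteq>\<^bsub>QHom Q (fst \<phi>) (fst \<psi>)\<^esub> \<Sqinter>\<^bsub>QHom Q (fst \<phi>) (fst \<psi>)\<^esub>(?r ` qob C) \<longleftrightarrow>
      (\<forall>x\<in>qob C. g \<sqsubseteq>\<^bsub>QHom Q (fst \<phi>) (fst \<psi>)\<^esub> ?r x)"
  proof
    assume le: "g \<sqsubseteq>\<^bsub>QHom Q (fst \<phi>) (fst \<psi>)\<^esub> \<Sqinter>\<^bsub>QHom Q (fst \<phi>) (fst \<psi>)\<^esub>(?r ` qob C)"
    show "\<forall>x\<in>qob C. g \<sqsubseteq>\<^bsub>QHom Q (fst \<phi>) (fst \<psi>)\<^esub> ?r x"
    proof
      fix x assume x: "x \<in> qob C"
      show "g \<sqsubseteq>\<^bsub>QHom Q (fst \<phi>) (fst \<psi>)\<^esub> ?r x"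
        by (rule L.le_trans[OF le L.inf_lower[OF sub imageI[OF x]] g L.inf_closed[OF sub] r[OF x]])
    qed
  next
    assume "\<forall>x\<in>qob C. g \<sqsubseteq>\<^bsub>QHom Q (fst \<phi>) (fst \<psi>)\<^esub> ?r x"
    then show "g \<sqsubseteq>\<^bsub>QHom Q (fst \<phi>) (fst \<psi>)\<^esub> \<Sqinter>\<^bsub>QHom Q (fst \<phi>) (fst \<psi>)\<^esub>(?r ` qob C)"
      using sub g by (intro L.inf_greatest) auto
  qed
  then show "g \<sqsubseteq>\<^bsub>QHom Q (fst \<phi>) (fst \<psi>)\<^esub> qhom (presheaf_qcat Q C) \<phi> \<psi> \<longleftrightarrow>
      (\<forall>x\<in>qob C. QComp Q (ext C x) (fst \<phi>) (fst \<psi>) g (snd \<phi> x) \<sqsubseteq>\<^bsub>QHom Q (ext C x) (fst \<psi>)\<^esub> snd \<psi> x)"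
    using res_pre_iff[OF ext_in ob arr g] by (simp add: presheaf_qcat_def)
qed

lemma qcategory_presheaf_qcat: "qcategory Q (presheaf_qcat Q C)"
proof
  fix \<phi> assume "\<phi> \<in> qob (presheaf_qcat Q C)"
  then have p: "is_presheaf Q C \<phi>" by (simp add: presheaf_qcat_def)
  then have ob: "fst \<phi> \<in> QOb Q"
    and arr: "\<And>x. x \<in> qob C \<Longrightarrow> snd \<phi> x \<in> carrier (QHom Q (ext C x) (fst \<phi>))"
    by (auto simp: is_presheaf_def)
  show "ext (presheaf_qcat Q C) \<phi> \<in> QOb Q" using ob by (simp add: presheaf_qcat_def)
  have id: "QIdent Q (fst \<phi>) \<in> carrier (QHom Q (fst \<phi>) (fst \<phi>))"
    using category.Ident_in[OF underlying_category] ob by (simp add: underlying_cat_def)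
  have "QComp Q (ext C x) (fst \<phi>) (fst \<phi>) (QIdent Q (fst \<phi>)) (snd \<phi> x)
      \<sqsubseteq>\<^bsub>QHom Q (ext C x) (fst \<phi>)\<^esub> snd \<phi> x" if x: "x \<in> qob C" for x
  proof -
    interpret L: complete_lattice "QHom Q (ext C x) (fst \<phi>)" using ob x ext_in hom_lattice by blast
    have "QComp Q (ext C x) (fst \<phi>) (fst \<phi>) (QIdent Q (fst \<phi>)) (snd \<phi> x) = snd \<phi> x"
      using category.Comp_Ident_left[OF underlying_category] ob ext_in[OF x] arr[OF x]
      by (simp add: underlying_cat_def)
    then show ?thesis using arr[OF x] by simp
  qed
  then show "QIdent Q (ext (presheaf_qcat Q C) \<phi>)
      \<sqsubseteq>\<^bsub>QHom Q (ext (presheaf_qcat Q C) \<phi>) (ext (presheaf_qcat Q C) \<phi>)\<^esub>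
      qhom (presheaf_qcat Q C) \<phi> \<phi>"
    using presheaf_hom_iff[OF p p id] by (simp add: presheaf_qcat_def)
next
  fix \<phi> \<psi> assume "\<phi> \<in> qob (presheaf_qcat Q C)" "\<psi> \<in> qob (presheaf_qcat Q C)"
  then show "qhom (presheaf_qcat Q C) \<phi> \<psi>
      \<in> carrier (QHom Q (ext (presheaf_qcat Q C) \<phi>) (ext (presheaf_qcat Q C) \<psi>))"
    using presheaf_hom_in by (simp add: presheaf_qcat_def)
next
  fix \<phi> \<psi> \<chi>
  assume "\<phi> \<in> qob (presheaf_qcat Q C)" "\<psi> \<in> qob (presheaf_qcat Q C)"
    "\<chi> \<in> qob (presheaf_qcat Q C)"
  then have p: "is_presheaf Q C \<phi>" "is_presheaf Q C \<psi>" "is_presheaf Q C \<chi>"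
    by (simp_all add: presheaf_qcat_def)
  then have ob: "fst \<phi> \<in> QOb Q" "fst \<psi> \<in> QOb Q" "fst \<chi> \<in> QOb Q"
    and arr: "\<And>x. x \<in> qob C \<Longrightarrow> snd \<phi> x \<in> carrier (QHom Q (ext C x) (fst \<phi>))"
      "\<And>x. x \<in> qob C \<Longrightarrow> snd \<psi> x \<in> carrier (QHom Q (ext C x) (fst \<psi>))"
      "\<And>x. x \<in> qob C \<Longrightarrow> snd \<chi> x \<in> carrier (QHom Q (ext C x) (fst \<chi>))"
    by (auto simp: is_presheaf_def)
  define f where "f = qhom (presheaf_qcat Q C) \<phi> \<psi>"
  define g where "g = qhom (presheaf_qcat Q C) \<psi> \<chi>"
  have f: "f \<in> carrier (QHom Q (fst \<phi>) (fst \<psi>))" and g: "g \<in> carrier (QHom Q (fst \<psi>) (fst \<chi>))"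
    unfolding f_def g_def using p presheaf_hom_in by blast+
  interpret fl: complete_lattice "QHom Q (fst \<phi>) (fst \<psi>)" using ob hom_lattice by blast
  interpret gl: complete_lattice "QHom Q (fst \<psi>) (fst \<chi>)" using ob hom_lattice by blast
  note gf = QComp_in[OF ob f g]
  have "QComp Q (ext C x) (fst \<phi>) (fst \<chi>) (QComp Q (fst \<phi>) (fst \<psi>) (fst \<chi>) g f) (snd \<phi> x)
      \<sqsubseteq>\<^bsub>QHom Q (ext C x) (fst \<chi>)\<^esub> snd \<chi> x" if x: "x \<in> qob C" for x
  proof -
    note e = ext_in[OF x] note a = arr[OF x]
    interpret L: complete_lattice "QHom Q (ext C x) (fst \<chi>)" using ob e hom_lattice by blast
    have fx: "QComp Q (ext C x) (fst \<phi>) (fst \<psi>) f (snd \<phi> x) \<sqsubseteq>\<^bsub>QHom Q (ext C x) (fst \<psi>)\<^esub> snd \<psi> x"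
      using presheaf_hom_iff[OF p(1,2) f] f x by (simp add: f_def)
    have gx: "QComp Q (ext C x) (fst \<psi>) (fst \<chi>) g (snd \<psi> x) \<sqsubseteq>\<^bsub>QHom Q (ext C x) (fst \<chi>)\<^esub> snd \<chi> x"
      using presheaf_hom_iff[OF p(2,3) g] g x by (simp add: g_def)
    note fc = QComp_in[OF e ob(1,2) a(1) f]
    have "QComp Q (ext C x) (fst \<phi>) (fst \<chi>) (QComp Q (fst \<phi>) (fst \<psi>) (fst \<chi>) g f) (snd \<phi> x) =
        QComp Q (ext C x) (fst \<psi>) (fst \<chi>) g (QComp Q (ext C x) (fst \<phi>) (fst \<psi>) f (snd \<phi> x))"
      using category.Comp_assoc[OF underlying_category, of "ext C x" "fst \<phi>" "fst \<psi>" "fst \<chi>"]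
        e ob a f g by (simp add: underlying_cat_def)
    moreover note QComp_mono_right[OF e ob(2,3) g fc a(2) fx]
    ultimately show ?thesis
      using L.le_trans[OF _ gx QComp_in[OF e ob(2,3) fc g] QComp_in[OF e ob(2,3) a(2) g] a(3)]
      by simp
  qed
  then show "QComp Q (ext (presheaf_qcat Q C) \<phi>) (ext (presheaf_qcat Q C) \<psi>)
      (ext (presheaf_qcat Q C) \<chi>) (qhom (presheaf_qcat Q C) \<psi> \<chi>) (qhom (presheaf_qcat Q C) \<phi> \<psi>)
      \<sqsubseteq>\<^bsub>QHom Q (ext (presheaf_qcat Q C) \<phi>) (ext (presheaf_qcat Q C) \<chi>)\<^esub>
      qhom (presheaf_qcat Q C) \<phi> \<chi>"
    using presheaf_hom_iff[OF p(1,3) gf] by (simp add: f_def g_def presheaf_qcat_def)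
qed

lemma qcategory_full_sub: "qcategory Q (full_sub C P)"
  by standard (auto simp: full_sub_def intro: ext_in qhom_in qhom_ident qhom_comp)

lemma qcategory_macneille_qcat: "qcategory Q (macneille_qcat Q C)"
  unfolding macneille_qcat_def by (rule qcategory.qcategory_full_sub[OF qcategory_presheaf_qcat])

end

lemma is_cosieve_sieve_up:
  assumes "faithful_functor E B p" "z \<in> Ob B" "is_sieve E B p z \<phi>"
  shows "is_cosieve E B p z (sieve_up E B p z \<phi>)"
  unfolding is_cosieve_def
proof (intro conjI ballI)
  interpret faithful_functor E B p by fact
  show "sieve_up E B p z \<phi> \<in> (\<Pi>\<^sub>E x\<in>Ob E. Pow (Hom B z (fob p x)))"
    by (auto simp: sieve_up_def)
  fix x y f g assume f: "x \<in> Ob E" "y \<in> Ob E" "f \<in> Hom E x y" and g: "g \<in> sieve_up E B p z \<phi> x"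
  note pf = fmap_in[OF f]
  from f g have gB: "g \<in> Hom B z (fob p x)" by (simp add: sieve_up_def)
  have "lifts E p w y (Comp B (fob p w) z (fob p y) (Comp B z (fob p x) (fob p y) (fmap p x y f) g) h)"
    if w: "w \<in> Ob E" and h: "h \<in> \<phi> w" for w h
  proof -
    obtain k where k: "k \<in> Hom E w x" "Comp B (fob p w) z (fob p x) g h = fmap p w x k"
      using g w h f by (auto simp: sieve_up_def lifts_def)
    have "h \<in> Hom B (fob p w) z" using assms(3) w h by (auto simp: is_sieve_def)
    then have "Comp B (fob p w) z (fob p y) (Comp B z (fob p x) (fob p y) (fmap p x y f) g) h
        = fmap p w y (Comp E w x y f k)"
      using cod.Comp_assoc[of "fob p w" z "fob p x" "fob p y" h g "fmap p x y f"]
        fmap_Comp[of w x y k f] assms(2) f w k gB pf fob_in by simp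
    then show ?thesis using dom.Comp_in[of w x y k f] w f k unfolding lifts_def by blast
  qed
  then show "Comp B z (fob p x) (fob p y) (fmap p x y f) g \<in> sieve_up E B p z \<phi> y"
    using f gB pf assms(2) fob_in cod.Comp_in by (simp add: sieve_up_def)
qed

lemma faithful_macneille_functor:
  assumes "faithful_functor E B p"
  shows "faithful_functor (macneille_cat E B p) B macneille_functor"
proof -
  interpret faithful_functor E B p by fact
  have cmp: "Comp B (fob p x) z v (Comp B z w v \<theta>' \<theta>) f \<in> \<chi> x"
    if "z \<in> Ob B" "w \<in> Ob B" "v \<in> Ob B" "\<theta> \<in> Hom B z w" "\<theta>' \<in> Hom B w v"
      "is_sieve E B p z \<phi>" "x \<in> Ob E" "f \<in> \<phi> x"
      "\<forall>x\<in>Ob E. \<forall>f\<in>\<phi> x. Comp B (fob p x) z w \<theta> f \<in> \<psi> x"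
      "\<forall>x\<in>Ob E. \<forall>f\<in>\<psi> x. Comp B (fob p x) w v \<theta>' f \<in> \<chi> x"
    for z w v \<theta> \<theta>' and \<phi> \<psi> \<chi> :: "'a \<Rightarrow> 'd set" and x f
  proof -
    have "f \<in> Hom B (fob p x) z" using that by (auto simp: is_sieve_def)
    then show ?thesis using that by (simp add: cod.Comp_assoc fob_in)
  qed
  have idn: "Comp B (fob p x) z z (Ident B z) f \<in> \<phi> x"
    if "z \<in> Ob B" "is_sieve E B p z \<phi>" "x \<in> Ob E" "f \<in> \<phi> x"
    for z and \<phi> :: "'a \<Rightarrow> 'd set" and x f
  proof -
    have "f \<in> Hom B (fob p x) z" using that by (auto simp: is_sieve_def)
    then show ?thesis using that by (simp add: cod.Comp_Ident_left fob_in)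
  qed
  interpret M: category "macneille_cat E B p"
    by standard (auto simp: macneille_cat_def cod.Ident_in idn cod.Comp_Ident_left
        cod.Comp_Ident_right cod.Comp_assoc intro: cod.Comp_in cmp)
  show ?thesis
    by standard (auto simp: macneille_cat_def macneille_functor_def)
qed

end

(* A presheaf on the enriched category of p is exactly a p-sieve. In the free quantaloid both
   residuals are given elementwise, by the arrows whose composites with all elements of one set
   lie in the other; so the Isbell adjunction is computed by the same formulas as the up and down
   operations on sieves and cosieves. Hence the two completions have the same objects and the
   same maps, and the identity is an isomorphism. *)

theory Submission
  imports Defs
begin

lemma free_quantaloid_simps [simp]:
  "QOb (free_quantaloid B) = Ob B"
  "carrier (QHom (free_quantaloid B) X Y) = Pow (Hom B X Y)"
  "U \<sqsubseteq>\<^bsub>QHom (free_quantaloid B) X Y\<^esub> V \<longleftrightarrow> U \<subseteq> V"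
  "QIdent (free_quantaloid B) X = {Ident B X}"
  "QComp (free_quantaloid B) X Y Z V U = {Comp B X Y Z v u | v u. v \<in> V \<and> u \<in> U}"
  by (simp_all add: free_quantaloid_def)

lemma qcat_of_functor_simps [simp]:
  "qob (qcat_of_functor E p) = Ob E"
  "ext (qcat_of_functor E p) = fob p"
  "qhom (qcat_of_functor E p) x y = fmap p x y ` Hom E x y"
  by (simp_all add: qcat_of_functor_def)

text \<open>The factor \<open>Hom B X Y\<close> matters for empty \<open>S\<close>, whose meet is
  the whole hom-set; this case arises for presheaf homs when the enriched category has no
  objects.\<close>

lemma Inf_free_quantaloid:
  "S \<subseteq> Pow (Hom B X Y) \<Longrightarrow> \<Sqinter>\<^bsub>QHom (free_quantaloid B) X Y\<^esub>S = Hom B X Y \<inter> \<Inter>S"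
  by (simp add: free_quantaloid_def Inf_Pow)

lemma partial_order_free_quantaloid: "partial_order (QHom (free_quantaloid B) X Y)"
  by standard (auto simp: free_quantaloid_def)

text \<open>Whether all composites of elements of a set \<open>V\<close> with elements of
  \<open>U\<close> lie in \<open>W\<close> is a condition on each element of \<open>V\<close>
  separately, so a largest such \<open>V\<close> exists and consists of the arrows satisfying
  it.\<close>

lemma res_pre_free_quantaloid:
  "res_pre (free_quantaloid B) X Y Z U W = {g \<in> Hom B Y Z. \<forall>f\<in>U. Comp B X Y Z g f \<in> W}"
  unfolding res_pre_def
  by (rule THE_right_adjoint[OF partial_order_free_quantaloid]) (simp, (simp, blast)+)

lemma res_post_free_quantaloid:
  "res_post (free_quantaloid B) X Y Z V W = {f \<in> Hom B X Y. \<forall>g\<in>V. Comp B X Y Z g f \<in> W}"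
  unfolding res_post_def
  by (rule THE_right_adjoint[OF partial_order_free_quantaloid]) (simp, (simp, blast)+)

lemma qhom_presheaf_qcat_free:
  "qhom (presheaf_qcat (free_quantaloid B) C) \<phi> \<psi> = {\<theta> \<in> Hom B (fst \<phi>) (fst \<psi>).
     \<forall>x\<in>qob C. \<forall>f\<in>snd \<phi> x. Comp B (ext C x) (fst \<phi>) (fst \<psi>) \<theta> f \<in> snd \<psi> x}"
  by (simp add: presheaf_qcat_def res_pre_free_quantaloid Inf_free_quantaloid image_subset_iff)
    blast

lemma qhom_copresheaf_qcat_free:
  "qhom (copresheaf_qcat (free_quantaloid B) C) \<phi> \<psi> = {\<theta> \<in> Hom B (fst \<phi>) (fst \<psi>).
     \<forall>x\<in>qob C. \<forall>g\<in>snd \<psi> x. Comp B (fst \<phi>) (fst \<psi>) (ext C x) g \<theta> \<in> snd \<phi> x}"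
  by (simp add: copresheaf_qcat_def res_post_free_quantaloid Inf_free_quantaloid image_subset_iff)
    blast

text \<open>The presheaf inequality, read elementwise, is closure under precomposition with the maps
  \<open>fmap p x y f\<close>.\<close>

lemma is_presheaf_qcat_of_functor:
  "is_presheaf (free_quantaloid B) (qcat_of_functor E p) (z, \<phi>) \<longleftrightarrow>
     z \<in> Ob B \<and> is_sieve E B p z \<phi>"
  unfolding is_presheaf_def is_sieve_def by simp blast

text \<open>Mapping into \<open>yoneda\<close> at \<open>x\<close> asks each composite to lie in the
  image of some \<open>Hom E y x\<close> under \<open>p\<close>, which is what \<open>lifts\<close>
  says.\<close>

lemma isbell_up_qcat_of_functor:
  "isbell_up (free_quantaloid B) (qcat_of_functor E p) (z, \<phi>) = (z, sieve_up E B p z \<phi>)"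
  unfolding isbell_up_def sieve_up_def qhom_presheaf_qcat_free yoneda_def lifts_def
  by (auto intro!: restrict_ext)

lemma isbell_down_qcat_of_functor:
  "isbell_down (free_quantaloid B) (qcat_of_functor E p) (z, \<psi>) = (z, cosieve_down E B p z \<psi>)"
  unfolding isbell_down_def cosieve_down_def qhom_copresheaf_qcat_free coyoneda_def lifts_def
  by (auto intro!: restrict_ext)

text \<open>The data are compared only on objects and maps, since the record fields are total
  functions with arbitrary values elsewhere.\<close>

lemma cat_functor_id:
  assumes "category C" "category D" "Ob C = Ob D"
    and "\<And>x y. \<lbrakk>x \<in> Ob C; y \<in> Ob C\<rbrakk> \<Longrightarrow> Hom C x y = Hom D x y"
    and "\<And>x. x \<in> Ob C \<Longrightarrow> Ident C x = Ident D x"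
    and "\<And>x y z f g. \<lbrakk>x \<in> Ob C; y \<in> Ob C; z \<in> Ob C; f \<in> Hom C x y; g \<in> Hom C y z\<rbrakk>
      \<Longrightarrow> Comp C x y z g f = Comp D x y z g f"
  shows "cat_functor C D id_functor"
proof -
  interpret dom: category C by fact
  interpret cod: category D by fact
  show ?thesis
    by standard (use assms in \<open>simp_all add: id_functor_def\<close>)
qed

theorem proposition7p4:
  fixes B :: "('o, 'b) cat" and E :: "('x, 'f) cat" and p :: "('x, 'f, 'o, 'b) ftor"
  assumes "category B"
    and "faithful_functor E B p"
  shows "iso_over B
    (cat_of_qcat B (macneille_qcat (free_quantaloid B) (qcat_of_functor E p)))
    (functor_of_qcat (macneille_qcat (free_quantaloid B) (qcat_of_functor E p)))
    (macneille_cat E B p) macneille_functor"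
proof -
  let ?R = "macneille_qcat (free_quantaloid B) (qcat_of_functor E p)"
  let ?D = "cat_of_qcat B ?R" and ?M = "macneille_cat E B p"
  interpret P: faithful_functor ?D B "functor_of_qcat ?R"
    using assms by (intro faithful_functor_of_qcat qcategory.qcategory_macneille_qcat
        qcategory_qcat_of_functor)
  interpret M: faithful_functor ?M B macneille_functor
    by (rule faithful_macneille_functor[OF assms(2)])
  \<comment> \<open>Both Isbell maps keep the extent, so the fixed-point equation for pairs reduces
    to the one for sieves.\<close>
  have ob: "Ob ?D = Ob ?M"
    by (auto simp: cat_of_qcat_def macneille_qcat_def full_sub_def macneille_cat_def
        presheaf_qcat_def is_presheaf_qcat_of_functor isbell_up_qcat_of_functor
        isbell_down_qcat_of_functor)
  have hom: "Hom ?D \<phi> \<psi> = Hom ?M \<phi> \<psi>" for \<phi> \<psi>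
    by (cases \<phi>; cases \<psi>) (simp add: cat_of_qcat_def macneille_qcat_def full_sub_def
        macneille_cat_def qhom_presheaf_qcat_free)
  \<comment> \<open>This makes composition in \<open>?D\<close> that of \<open>B\<close> between
    first components, and makes the two projections to \<open>B\<close> agree.\<close>
  have ext: "ext ?R = fst"
    by (simp add: macneille_qcat_def full_sub_def presheaf_qcat_def)
  have ident: "Ident ?D \<phi> = Ident ?M \<phi>" for \<phi>
    by (cases \<phi>) (simp add: cat_of_qcat_def macneille_cat_def ext)
  have comp: "Comp ?D \<phi> \<psi> \<chi> = Comp ?M \<phi> \<psi> \<chi>" for \<phi> \<psi> \<chi>
    by (cases \<phi>; cases \<psi>; cases \<chi>) (simp add: cat_of_qcat_def macneille_cat_def ext)
  have "cat_functor ?D ?M id_functor" "cat_functor ?M ?D id_functor"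
    using P.dom.category_axioms M.dom.category_axioms
    by (auto intro!: cat_functor_id simp: ob hom ident comp)
  then show ?thesis
    unfolding iso_over_def using P.cat_functor_axioms M.cat_functor_axioms
    by (intro conjI exI[of _ id_functor])
      (simp_all add: functor_eq_def functor_comp_def id_functor_def functor_of_qcat_def
        macneille_functor_def ext)
qed

end
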